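(* Let $f(q,r,s,t)$ and $g(q,r,s,t)$, $q,r,s,t\ge 0$, be of exponential order, such that the integral $$F[(h,j,k,l),(m,n,o,p)]=\int_0^\infty\int_0^\infty\int_0^\infty\int_0^\infty e^{-\left(\frac{hq}{m}+\frac{jr}{n}+\frac{ks}{o}+\frac{lt}{p}\right)}f(q,r,s,t)\,dq\,dr\,ds\,dt$$ converges, and, in addition, such that the integral $$G[(h,j,k,l),(m,n,o,p)]=\int_0^\infty\int_0^\infty\int_0^\infty\int_0^\infty e^{-\left(\frac{hq}{m}+\frac{jr}{n}+\frac{ks}{o}+\frac{lt}{p}\right)}g(q,r,s,t)\,dq\,dr\,ds\,dt$$ converges absolutely. Then $$\mathbb{H}^4_{qrst}[(f****g)(q,r,s,t)]=\mathbb{H}^4_{qrst}[f(q,r,s,t)]\;\mathbb{H}^4_{qrst}[g(q,r,s,t)].$$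
   Context: Quadruple Shehu transform: for a continuous function $f(q,r,s,t)$ of four variables $q,r,s,t\ge 0$ and parameters (Shehu variables) $h,j,k,l,m,n,o,p>0$, $$\mathbb{H}^4_{qrst}[f(q,r,s,t)]=F[(h,j,k,l),(m,n,o,p)]=\int_0^\infty\int_0^\infty\int_0^\infty\int_0^\infty e^{-\left(\frac{hq}{m}+\frac{jr}{n}+\frac{ks}{o}+\frac{lt}{p}\right)}f(q,r,s,t)\,dq\,dr\,ds\,dt,$$ provided the integral exists. Exponential order: $f$ is of exponential order if there are constants $a,b,c,d>0$ with $$\sup_{q,r,s,t>0}\frac{|f(q,r,s,t)|}{e^{aq+br+cs+dt}}<\infty.$$ Convolution: $$(f****g)(q,r,s,t)=\int_0^q\int_0^r\int_0^s\int_0^t f(q-t_1,r-t_2,s-t_3,t-t_4)\,g(t_1,t_2,t_3,t_4)\,dt_4\,dt_3\,dt_2\,dt_1$$ $$=\int_0^q\int_0^r\int_0^s\int_0^t g(q-t_1,r-t_2,s-t_3,t-t_4)\,f(t_1,t_2,t_3,t_4)\,dt_4\,dt_3\,dt_2\,dt_1,$$ where $t_1\in[0,q]$, $t_2\in[0,r]$, $t_3\in[0,s]$, $t_4\in[0,t]$.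
   Formalization: "F converges" is taken as bounded convergence: the integrals over boxes [0,Q]×[0,R]×[0,S]×[0,T] have a limit and stay bounded. Without the boundedness the claim fails, since the transform of f****g need not exist. *)

theory Defs
  imports "HOL-Analysis.Analysis"
begin

definition orthant4 :: "(real \<times> real \<times> real \<times> real) set" where
  "orthant4 = {0..} \<times> {0..} \<times> {0..} \<times> {0..}"

definition exponential_order4 :: "(real \<Rightarrow> real \<Rightarrow> real \<Rightarrow> real \<Rightarrow> real) \<Rightarrow> bool" where
  "exponential_order4 f \<longleftrightarrow>
     (\<exists>a>0. \<exists>b>0. \<exists>c>0. \<exists>d>0.
        bdd_above ((\<lambda>(q, r, s, t). \<bar>f q r s t\<bar> / exp (a * q + b * r + c * s + d * t)) `
                   ({0<..} \<times> {0<..} \<times> {0<..} \<times> {0<..})))"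

fun shehu4_integrand ::
  "(real \<Rightarrow> real \<Rightarrow> real \<Rightarrow> real \<Rightarrow> real) \<Rightarrow>
   real \<times> real \<times> real \<times> real \<Rightarrow> real \<times> real \<times> real \<times> real \<Rightarrow>
   real \<times> real \<times> real \<times> real \<Rightarrow> real" where
  "shehu4_integrand f (h, j, k, l) (m, n, o', p) (q, r, s, t) =
     exp (- (h * q / m + j * r / n + k * s / o' + l * t / p)) * f q r s t"

text \<open>
  The integral is the Henstock-Kurzweil integral over the closed orthant. For a
  continuous integrand it is the limit of the integrals over the boxes
  [0,Q] x [0,R] x [0,S] x [0,T] as Q, R, S, T tend to infinity independently, so
  convergence need not be absolute.
\<close>

definition shehu4 ::
  "(real \<Rightarrow> real \<Rightarrow> real \<Rightarrow> real \<Rightarrow> real) \<Rightarrow>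
   real \<times> real \<times> real \<times> real \<Rightarrow> real \<times> real \<times> real \<times> real \<Rightarrow> real" where
  "shehu4 f v w = integral orthant4 (shehu4_integrand f v w)"

text \<open>
  Convergence of a multiple Laplace-type integral is taken in the customary sense of
  bounded convergence: the limit over boxes exists and the box integrals are bounded.
  Unlike in one variable, the boundedness does not follow from the existence of the
  limit. It is automatic when the integral converges absolutely. Without it the
  convolution theorem fails: for integrands (including the kernel)
  a(q) exp(r - s - t) and exp(- q - r - s - t), where a is continuous with support
  in [0,1], integral 0 and antiderivative A from 0 that is nonnegative and not
  identically 0, the first has integral 0 over every box with Q at least 1, but the
  box integrals of the convolution are a positive constant times
  exp(-Q) (cosh R - 1) times factors in S and T that tend to 1.
\<close>

definition shehu4_converges_boundedly ::
  "(real \<Rightarrow> real \<Rightarrow> real \<Rightarrow> real \<Rightarrow> real) \<Rightarrow>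
   real \<times> real \<times> real \<times> real \<Rightarrow> real \<times> real \<times> real \<times> real \<Rightarrow> bool" where
  "shehu4_converges_boundedly f v w \<longleftrightarrow>
     shehu4_integrand f v w integrable_on orthant4 \<and>
     bounded ((\<lambda>(Q, R, S, T).
        integral ({0..Q} \<times> {0..R} \<times> {0..S} \<times> {0..T}) (shehu4_integrand f v w)) ` orthant4)"

definition shehu4_converges_absolutely ::
  "(real \<Rightarrow> real \<Rightarrow> real \<Rightarrow> real \<Rightarrow> real) \<Rightarrow>
   real \<times> real \<times> real \<times> real \<Rightarrow> real \<times> real \<times> real \<times> real \<Rightarrow> bool" where
  "shehu4_converges_absolutely f v w \<longleftrightarrow>
     shehu4_integrand f v w absolutely_integrable_on orthant4"

definition convolution4 ::
  "(real \<Rightarrow> real \<Rightarrow> real \<Rightarrow> real \<Rightarrow> real) \<Rightarrow> (real \<Rightarrow> real \<Rightarrow> real \<Rightarrow> real \<Rightarrow> real) \<Rightarrow>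
   real \<Rightarrow> real \<Rightarrow> real \<Rightarrow> real \<Rightarrow> real" where
  "convolution4 f g q r s t =
     integral {0..q} (\<lambda>t1. integral {0..r} (\<lambda>t2. integral {0..s} (\<lambda>t3. integral {0..t} (\<lambda>t4.
       f (q - t1) (r - t2) (s - t3) (t - t4) * g t1 t2 t3 t4))))"

end

theory Submission
  imports Defs
begin

text \<open>
  The exponential kernel is multiplicative, so it can be absorbed into the functions: the
  integrand of the convolution of f and g is the convolution of the integrands \<phi> and \<gamma>. By
  Fubini, the integral of the latter over the box [0,X] is the integral over t in [0,X] of
  \<Phi>(X - t) \<gamma>(t), where \<Phi>(X) is the integral of \<phi> over [0,X]. As \<Phi> is bounded and converges,
  and \<gamma> is absolutely integrable, dominated convergence gives the limit as X tends to infinity.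
  The argument takes place on the positive cone of an ordered Euclidean space.
\<close>

section \<open>Fubini for the convolution over a box\<close>

lemma set_integrable_box:
  fixes f :: "'a::ordered_euclidean_space \<Rightarrow> real"
  assumes "continuous_on {a..b} f"
  shows "set_integrable lborel {a..b} f"
  unfolding set_integrable_def using assms
  by (intro borel_integrable_compact) (auto simp: cbox_interval [symmetric])

text \<open>Both sides are iterated integrals of one function \<open>H\<close>, supported where 0
  \<le> t \<le> x \<le> X. It is bounded with bounded support, hence integrable, so the order of
  integration may be exchanged; translating by t turns the inner integral over x into one of
  \<open>f\<close> over \<open>{0..X - t}\<close>.\<close>

lemma convolution_box:
  fixes f g :: "'a::ordered_euclidean_space \<Rightarrow> real"
  assumes f: "continuous_on {0..} f" and g: "continuous_on {0..} g" and "0 \<le> X"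
  defines "c \<equiv> \<lambda>x. integral {0..x} (\<lambda>t. f (x - t) * g t)"
    and "d \<equiv> \<lambda>t. integral {0..X - t} f * g t"
  shows "c integrable_on {0..X}" "d integrable_on {0..X}"
    and "integral {0..X} c = integral {0..X} d"
proof -
  \<comment> \<open>Continuity is known only on the cone; cutting off to the compact box gives
    functions that are bounded and Borel measurable on the whole space.\<close>
  define a where "a x = indicator {0..X} x * f x" for x
  define b where "b x = indicator {0..X} x * g x" for x
  have fX: "continuous_on {0..X} f" and gX: "continuous_on {0..X} g"
    using f g by (auto elim: continuous_on_subset)
  have [measurable]: "a \<in> borel_measurable borel" "b \<in> borel_measurable borel"
    using borel_measurable_continuous_on_indicator [OF _ fX]
      borel_measurable_continuous_on_indicator [OF _ gX]
    by (auto simp: a_def [abs_def] b_def [abs_def] cbox_interval [symmetric])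
  have "bounded (f ` {0..X})" "bounded (g ` {0..X})"
    using fX gX compact_cbox [of 0 X]
    by (auto simp: cbox_interval intro!: compact_imp_bounded compact_continuous_image)
  then obtain A B where A: "\<And>x. x \<in> {0..X} \<Longrightarrow> \<bar>f x\<bar> \<le> A"
    and B: "\<And>x. x \<in> {0..X} \<Longrightarrow> \<bar>g x\<bar> \<le> B"
    unfolding bounded_iff by (metis imageI real_norm_def)
  have "0 \<le> A" "0 \<le> B"
    using A [of 0] B [of 0] \<open>0 \<le> X\<close> by auto
  have a_le: "\<bar>a x\<bar> \<le> A" for x
    using A [of x] \<open>0 \<le> A\<close> by (auto simp: a_def indicator_def)
  have b_le: "\<bar>b x\<bar> \<le> indicator {0..X} x * B" for x
    using B [of x] \<open>0 \<le> B\<close> by (auto simp: b_def indicator_def)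
  \<comment> \<open>The product \<open>a (x - t) * b t\<close> alone can reach up to x = 2X; the
    extra indicator cuts x off at X.\<close>
  define H where "H = (\<lambda>(x, t). indicator {0..X} x * (a (x - t) * b t))"
  have H_int: "integrable (lborel \<Otimes>\<^sub>M lborel) H"
  proof (rule Bochner_Integration.integrable_bound)
    have "integrable lborel (indicator (cbox (0, 0) (X, X)) :: 'a \<times> 'a \<Rightarrow> real)"
      by (simp add: integrable_indicator_iff emeasure_lborel_cbox_finite [unfolded infinity_ennreal_def])
    then show "integrable (lborel \<Otimes>\<^sub>M lborel)
        (\<lambda>z :: 'a \<times> 'a. indicator (cbox (0, 0) (X, X)) z * (A * B) :: real)"
      unfolding lborel_prod by simp
    have [measurable]: "{0..X} \<in> sets borel"
      by (simp add: cbox_interval [symmetric])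
    show "H \<in> borel_measurable (lborel \<Otimes>\<^sub>M lborel)"
      unfolding H_def by measurable
    show "AE z in lborel \<Otimes>\<^sub>M lborel.
        norm (H z) \<le> norm (indicator (cbox (0, 0) (X, X)) z * (A * B) :: real)"
    proof (intro AE_I2, clarify)
      fix x t :: 'a
      have "\<bar>H (x, t)\<bar> \<le> indicator {0..X} x * (A * (indicator {0..X} t * B))"
        unfolding H_def using a_le [of "x - t"] b_le [of t] \<open>0 \<le> A\<close>
        by (auto simp: abs_mult intro!: mult_mono)
      then show "norm (H (x, t)) \<le> norm (indicator (cbox (0, 0) (X, X)) (x, t) * (A * B))"
        using \<open>0 \<le> A\<close> \<open>0 \<le> B\<close>
        by (auto simp: indicator_def cbox_Pair_eq cbox_interval split: if_splits)
    qed
  qed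
  have inner_t: "(\<integral>t. H (x, t) \<partial>lborel) = indicator {0..X} x *\<^sub>R c x" for x
  proof (cases "x \<in> {0..X}")
    case True
    \<comment> \<open>From 0 \<le> t and x \<le> X follows x - t \<le> X, so the cutoff of
      \<open>f\<close> at X loses nothing.\<close>
    have "H (x, t) = indicator {0..x} t *\<^sub>R (f (x - t) * g t)" for t
      using True by (auto simp: H_def a_def b_def indicator_def intro: order_trans
        dest: diff_left_mono [of 0 t x])
    moreover have "set_integrable lborel {0..x} (\<lambda>t. f (x - t) * g t)"
      by (intro set_integrable_box continuous_intros continuous_on_subset [OF g]
          continuous_on_compose2 [OF f]) auto
    ultimately show ?thesis
      using True set_borel_integral_eq_integral(2) [of "{0..x}" "\<lambda>t. f (x - t) * g t"]
      by (simp add: c_def set_lebesgue_integral_def)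
  qed (simp add: H_def)
  have inner_x: "(\<integral>x. H (x, t) \<partial>lborel) = indicator {0..X} t *\<^sub>R d t" for t
  proof (cases "t \<in> {0..X}")
    case True
    have shift: "integral {t..X} (\<lambda>x. f (x - t)) = integral {0..X - t} f"
      using integral_shift_cbox [of 0 "- t" "X - t" f] by (simp add: cbox_interval)
    have "H (x, t) = indicator {t..X} x *\<^sub>R (f (x - t) * g t)" for x
      using True by (auto simp: H_def a_def b_def indicator_def intro: order_trans
        dest: diff_left_mono [of 0 t x])
    moreover have "set_integrable lborel {t..X} (\<lambda>x. f (x - t) * g t)"
      by (intro set_integrable_box continuous_intros continuous_on_compose2 [OF f]) auto
    ultimately have "(\<integral>x. H (x, t) \<partial>lborel) = integral {t..X} (\<lambda>x. f (x - t) * g t)"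
      by (simp only: set_lebesgue_integral_def set_borel_integral_eq_integral(2) [symmetric])
    then show ?thesis
      using True shift by (simp add: d_def)
  qed (simp add: H_def b_def)
  have c: "set_integrable lborel {0..X} c"
    using lborel_pair.integrable_fst' [OF H_int]
    by (simp add: set_integrable_def inner_t)
  have d: "set_integrable lborel {0..X} d"
    using lborel_pair.integrable_snd [of "\<lambda>x t. H (x, t)"] H_int
    by (simp add: set_integrable_def inner_x)
  show "c integrable_on {0..X}" "d integrable_on {0..X}"
    using c d by (auto intro: set_borel_integral_eq_integral)
  show "integral {0..X} c = integral {0..X} d"
    using lborel_pair.Fubini_integral [of "\<lambda>x t. H (x, t)"] H_int
     set_borel_integral_eq_integral(2) [OF c]  set_borel_integral_eq_integral(2) [OF d]
    by (simp add: set_lebesgue_integral_def inner_x inner_t)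
qed

section \<open>Passage from boxes to the whole cone\<close>

lemma bounds_of_ball_subset_cbox:
  fixes a b x :: "'a::ordered_euclidean_space"
  assumes "ball 0 B \<subseteq> cbox a b" "norm x < B"
  shows "a \<le> x" "x \<le> b"
  using assms by (auto simp: cbox_interval subset_iff)

text \<open>The integral over the cone is a limit over all boxes containing a large ball. Such boxes
  have a lower corner below 0, so only the upper corner matters.\<close>

lemma integral_restrict_nonneg:
  fixes f :: "'a::ordered_euclidean_space \<Rightarrow> real"
  assumes "a \<le> 0"
  shows "integral (cbox a b) (\<lambda>x. if x \<in> {0..} then f x else 0) = integral {0..b} f"
proof -
  have "{0..} \<inter> cbox a b = {0..b}"
    using assms by (auto simp: cbox_interval intro: order_trans)
  then show ?thesis
    using Henstock_Kurzweil_Integration.integral_restrict_Int [of "cbox a b" "{0..}" f] by simp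
qed

text \<open>The bound \<open>M\<close> on the box integrals of \<open>f\<close> supplies the
  majorant \<open>M * \<bar>g t\<bar>\<close>. The second conclusion lets the convolution inherit
  bounded convergence.\<close>

lemma convolution_has_integral:
  fixes f g :: "'a::ordered_euclidean_space \<Rightarrow> real"
  assumes f: "continuous_on {0..} f" and g: "continuous_on {0..} g"
    and L: "(f has_integral L) {0..}"
    and M: "\<And>X. 0 \<le> X \<Longrightarrow> \<bar>integral {0..X} f\<bar> \<le> M"
    and abs_g: "g absolutely_integrable_on {0..}"
  defines "c \<equiv> \<lambda>x. integral {0..x} (\<lambda>t. f (x - t) * g t)"
  shows "(c has_integral L * integral {0..} g) {0..}"
    and "0 \<le> X \<Longrightarrow> \<bar>integral {0..X} c\<bar> \<le> M * integral {0..} (\<lambda>t. \<bar>g t\<bar>)"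
proof -
  \<comment> \<open>Extension by zero gives all X the common domain \<open>{0..}\<close> that
    dominated convergence requires.\<close>
  define D where "D X t = (if t \<in> {0..X} then integral {0..X - t} f * g t else 0)" for X t
  have "0 \<le> M"
    using M [of 0] by simp
  have box: "{0..X} \<inter> {0..} = {0..X}" for X :: 'a
    by auto
  have D_int: "D X integrable_on {0..}" if "0 \<le> X" for X
    using convolution_box(2) [OF f g that] unfolding D_def
    by (simp add: integrable_restrict_Int box del: atLeastAtMost_iff)
  have c_D: "integral {0..X} c = integral {0..} (D X)" if "0 \<le> X" for X
    using convolution_box(3) [OF f g that] unfolding D_def c_def
    by (simp add: Henstock_Kurzweil_Integration.integral_restrict_Int box del: atLeastAtMost_iff)
  have D_le: "\<bar>D X t\<bar> \<le> M * \<bar>g t\<bar>" for X t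
    using M [of "X - t"] \<open>0 \<le> M\<close> by (auto simp: D_def abs_mult intro: mult_right_mono)
  have Mg: "(\<lambda>t. M * \<bar>g t\<bar>) integrable_on {0..}"
    using abs_g integrable_on_mult_right [of "\<lambda>t. \<bar>g t\<bar>" "{0..}" M]
    by (simp add: absolutely_integrable_on_def)
  show "\<bar>integral {0..X} c\<bar> \<le> M * integral {0..} (\<lambda>t. \<bar>g t\<bar>)" if "0 \<le> X"
    using integral_norm_bound_integral [OF D_int Mg, of X] that D_le
    by (simp add: c_D)
  have D_lim: "(\<lambda>i. D (b i) t) \<longlonglongrightarrow> L * g t"
    if b: "\<And>i. ball 0 (real i) \<subseteq> cbox (a i) (b i)" and "0 \<le> t" for a b :: "nat \<Rightarrow> 'a" and t
  proof -
    have "(\<lambda>i. integral {0..b i - t} f) \<longlonglongrightarrow> L"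
    proof (rule LIMSEQ_I)
      fix e :: real assume "e > 0"
      then obtain B where "B > 0" and B: "\<And>a b. ball 0 B \<subseteq> cbox a b \<Longrightarrow>
          norm (integral (cbox a b) (\<lambda>x. if x \<in> {0..} then f x else 0) - L) < e"
        using L unfolding has_integral_alt' by metis
      \<comment> \<open>Translating the box by -t costs at most \<open>norm t\<close> in radius, so
        the translated box still contains the ball of radius \<open>B\<close>.\<close>
      have "norm (integral {0..b i - t} f - L) < e" if i: "B + norm t \<le> real i" for i
      proof -
        have "ball 0 B \<subseteq> cbox (a i - t) (b i - t)"
        proof
          fix x :: 'a assume "x \<in> ball 0 B"
          then have "x + t \<in> ball 0 (real i)"
            using i norm_triangle_ineq [of x t] by simp
          then have "x + t \<in> cbox (a i) (b i)"
            using b by blast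
          then show "x \<in> cbox (a i - t) (b i - t)"
            by (simp add: cbox_interval algebra_simps)
        qed
        moreover from this have "a i - t \<le> 0"
          using \<open>B > 0\<close> by (intro bounds_of_ball_subset_cbox(1)) simp_all
        ultimately show ?thesis
          using B integral_restrict_nonneg by metis
      qed
      then show "\<exists>i0. \<forall>i\<ge>i0. norm (integral {0..b i - t} f - L) < e"
        using real_arch_simple [of "B + norm t"] by (meson of_nat_mono order_trans)
    qed
    \<comment> \<open>Once i exceeds \<open>norm t\<close>, the point t lies in the ball of radius i
      and hence below \<open>b i\<close>.\<close>
    moreover have "eventually (\<lambda>i. D (b i) t = integral {0..b i - t} f * g t) sequentially"
    proof -
      obtain i0 where i0: "norm t < real i0"
        using reals_Archimedean2 by blast
      have "t \<in> {0..b i}" if "i0 \<le> i" for i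
        using bounds_of_ball_subset_cbox(2) [OF b [of i], of t] i0 that \<open>0 \<le> t\<close> by simp
      then show ?thesis
        unfolding eventually_sequentially D_def by auto
    qed
    ultimately show ?thesis
      by (auto intro: tendsto_mult_right tendsto_cong [THEN iffD2])
  qed
  show "(c has_integral L * integral {0..} g) {0..}"
    unfolding has_integral_alt'
  proof (intro conjI allI impI)
    fix a b :: 'a
    \<comment> \<open>Here b need not lie in the cone; \<open>sup 0 b\<close> does, and the box from
      0 to it contains the intersection.\<close>
    have box: "{0..} \<inter> cbox a b = cbox (sup 0 a) b"
      by (auto simp: cbox_interval)
    have "c integrable_on cbox 0 (sup 0 b)"
      unfolding c_def cbox_interval by (intro convolution_box f g) simp
    then have "c integrable_on {0..} \<inter> cbox a b"
      unfolding box by (rule integrable_on_subcbox) (auto simp: cbox_interval intro: le_supI2)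
    then show "(\<lambda>x. if x \<in> {0..} then c x else 0) integrable_on cbox a b"
      by (simp only: integrable_restrict_Int)
  next
    fix e :: real assume "e > 0"
    show "\<exists>B>0. \<forall>a b. ball 0 B \<subseteq> cbox a b \<longrightarrow>
        norm (integral (cbox a b) (\<lambda>x. if x \<in> {0..} then c x else 0) - L * integral {0..} g) < e"
    \<comment> \<open>If the limit failed, each radius would admit a bad box; choosing one per
      radius gives a sequence of upper corners to which dominated convergence applies. The radii are
      \<open>Suc i\<close> because they must be positive.\<close>
    proof (rule ccontr)
      assume "\<not> ?thesis"
      then have "\<forall>i. \<exists>a b. ball 0 (real (Suc i)) \<subseteq> cbox a b \<and>
        e \<le> norm (integral (cbox a b) (\<lambda>x. if x \<in> {0..} then c x else 0) - L * integral {0..} g)"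
        by (metis not_less of_nat_0_less_iff zero_less_Suc)
      then obtain a b where ab: "\<And>i. ball 0 (real (Suc i)) \<subseteq> cbox (a i) (b i)"
        and e: "\<And>i. e \<le> norm (integral (cbox (a i) (b i)) (\<lambda>x. if x \<in> {0..} then c x else 0) -
          L * integral {0..} g)"
        by metis
      have a: "a i \<le> 0" and b: "0 \<le> b i" for i
        using bounds_of_ball_subset_cbox [OF ab [of i], of 0] by simp_all
      then have le: "e \<le> norm (integral {0..} (D (b i)) - L * integral {0..} g)" for i
        using e [of i] by (simp only: integral_restrict_nonneg [OF a] c_D [OF b])
      have ball: "ball 0 (real i) \<subseteq> cbox (a i) (b i)" for i
        using ab [of i] by force
      have "(\<lambda>i. integral {0..} (D (b i))) \<longlonglongrightarrow> integral {0..} (\<lambda>t. L * g t)"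
        using D_int Mg D_le b D_lim [OF ball]
        by (intro dominated_convergence(2)) auto
      then show False
        using LIMSEQ_D [OF _ \<open>e > 0\<close>] le by (fastforce simp: not_less [symmetric])
    qed
  qed
qed

section \<open>The orthant as positive cone under the componentwise order, and iterated
  integrals\<close>

lemma orthant4_eq: "orthant4 = {0..}"
  by (auto simp: orthant4_def less_eq_prod_def zero_prod_def)

lemma box4_eq: "{0..Q} \<times> {0..R} \<times> {0..S} \<times> {0..T::real} = {0..(Q::real, R::real, S::real, T)}"
  by (auto simp: less_eq_prod_def zero_prod_def)

text \<open>This links the iterated integrals in \<open>convolution4\<close> to the integral over a
  single box, splitting off one coordinate at a time. A corner with a negative coordinate gives an
  empty box and 0 on both sides.\<close>

lemma integral_box4:
  fixes f :: "real \<times> real \<times> real \<times> real \<Rightarrow> real"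
  assumes "continuous_on {0..(q, r, s, t)} f"
  shows "integral {0..(q, r, s, t)} f =
    integral {0..q} (\<lambda>t1. integral {0..r} (\<lambda>t2. integral {0..s} (\<lambda>t3. integral {0..t} (\<lambda>t4.
      f (t1, t2, t3, t4)))))"
proof -
  have f: "continuous_on ({0..q} \<times> {0..r} \<times> {0..s} \<times> {0..t}) f"
    using assms by (simp add: box4_eq)
  have 1: "integral (cbox (0, 0, 0, 0) (q, r, s, t)) f =
    integral {0..q} (\<lambda>t1. integral (cbox (0, 0, 0) (r, s, t)) (\<lambda>y. f (t1, y)))"
    using f by (subst integral_prod_continuous) (simp_all add: cbox_Pair_eq)
  have 2: "integral (cbox (0, 0, 0) (r, s, t)) (\<lambda>y. f (t1, y)) =
    integral {0..r} (\<lambda>t2. integral (cbox (0, 0) (s, t)) (\<lambda>y. f (t1, t2, y)))"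
    if "t1 \<in> {0..q}" for t1
    using that by (subst integral_prod_continuous)
      (auto simp: cbox_Pair_eq intro!: continuous_on_compose2 [OF f] continuous_intros)
  have 3: "integral (cbox (0, 0) (s, t)) (\<lambda>y. f (t1, t2, y)) =
    integral {0..s} (\<lambda>t3. integral {0..t} (\<lambda>t4. f (t1, t2, t3, t4)))"
    if "t1 \<in> {0..q}" "t2 \<in> {0..r}" for t1 t2
    using that by (subst integral_prod_continuous)
      (auto simp: cbox_Pair_eq intro!: continuous_on_compose2 [OF f] continuous_intros)
  have "{0..(q, r, s, t)} = cbox (0, 0, 0, 0) (q, r, s, t)"
    by (simp add: cbox_interval zero_prod_def)
  then have "integral {0..(q, r, s, t)} f = integral (cbox (0, 0, 0, 0) (q, r, s, t)) f"
    by simp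
  also note 1
  also have "integral {0..q} (\<lambda>t1. integral (cbox (0, 0, 0) (r, s, t)) (\<lambda>y. f (t1, y))) =
    integral {0..q} (\<lambda>t1. integral {0..r} (\<lambda>t2. integral (cbox (0, 0) (s, t)) (\<lambda>y. f (t1, t2, y))))"
    by (intro Henstock_Kurzweil_Integration.integral_cong 2)
  also have "\<dots> = integral {0..q} (\<lambda>t1. integral {0..r} (\<lambda>t2. integral {0..s} (\<lambda>t3. integral {0..t} (\<lambda>t4.
      f (t1, t2, t3, t4)))))"
    by (intro Henstock_Kurzweil_Integration.integral_cong 3)
  finally show ?thesis .
qed

lemma continuous_on_shehu4_integrand:
  assumes "continuous_on orthant4 (\<lambda>(q, r, s, t). f q r s t)"
  shows "continuous_on {0..} (shehu4_integrand f (h, j, k, l) (m, n, o', p))"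
proof -
  \<comment> \<open>Projections replace pattern matching on tuples, so that the continuity rules
    apply to the exponent.\<close>
  have "shehu4_integrand f (h, j, k, l) (m, n, o', p) =
    (\<lambda>x. exp (- (h * fst x / m + j * fst (snd x) / n + k * fst (snd (snd x)) / o' +
        l * snd (snd (snd x)) / p)) * (case x of (q, r, s, t) \<Rightarrow> f q r s t))"
    by auto
  then show ?thesis
    using assms unfolding orthant4_eq
    by (auto simp: divide_inverse intro!: continuous_intros)
qed

text \<open>The exponent is linear, so the kernels at x - t and t multiply to the kernel at x, which
  is constant in t and leaves all four integrals. Outside the cone both sides are 0, so the identity
  is one of functions on the whole space.\<close>

lemma shehu4_integrand_convolution4:
  fixes f g :: "real \<Rightarrow> real \<Rightarrow> real \<Rightarrow> real \<Rightarrow> real" and h j k l m n o' p :: real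
  defines "\<phi> \<equiv> \<lambda>f. shehu4_integrand f (h, j, k, l) (m, n, o', p)"
  assumes f: "continuous_on orthant4 (\<lambda>(q, r, s, t). f q r s t)"
    and g: "continuous_on orthant4 (\<lambda>(q, r, s, t). g q r s t)"
  shows "\<phi> (convolution4 f g) x = integral {0..x} (\<lambda>t. \<phi> f (x - t) * \<phi> g t)"
proof (cases x)
  case (fields q r s t)
  let ?E = "exp (- (h * q / m + j * r / n + k * s / o' + l * t / p))"
  have "continuous_on {0..x} (\<lambda>t. \<phi> f (x - t) * \<phi> g t)"
    unfolding \<phi>_def
    by (intro continuous_intros continuous_on_compose2 [OF continuous_on_shehu4_integrand [OF f]]
        continuous_on_subset [OF continuous_on_shehu4_integrand [OF g]]) auto
  then have "integral {0..x} (\<lambda>t. \<phi> f (x - t) * \<phi> g t) =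
    integral {0..q} (\<lambda>t1. integral {0..r} (\<lambda>t2. integral {0..s} (\<lambda>t3. integral {0..t} (\<lambda>t4.
       \<phi> f (q - t1, r - t2, s - t3, t - t4) * \<phi> g (t1, t2, t3, t4)))))"
    unfolding fields by (subst integral_box4) simp_all
  moreover have "\<phi> f (q - t1, r - t2, s - t3, t - t4) * \<phi> g (t1, t2, t3, t4) =
      ?E * (f (q - t1) (r - t2) (s - t3) (t - t4) * g t1 t2 t3 t4)" for t1 t2 t3 t4
    by (simp add: \<phi>_def exp_add [symmetric] diff_divide_distrib right_diff_distrib mult_ac)
  ultimately show ?thesis
    by (simp only: fields \<phi>_def convolution4_def shehu4_integrand.simps integral_mult_right)
qed

theorem theorem4:
  fixes f g :: "real \<Rightarrow> real \<Rightarrow> real \<Rightarrow> real \<Rightarrow> real"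
    and h j k l m n o' p :: real
  assumes "h > 0" "j > 0" "k > 0" "l > 0" "m > 0" "n > 0" "o' > 0" "p > 0"
    and "continuous_on orthant4 (\<lambda>(q, r, s, t). f q r s t)"
    and "continuous_on orthant4 (\<lambda>(q, r, s, t). g q r s t)"
    and "exponential_order4 f"
    and "exponential_order4 g"
    and "shehu4_converges_boundedly f (h, j, k, l) (m, n, o', p)"
    and "shehu4_converges_absolutely g (h, j, k, l) (m, n, o', p)"
  shows "shehu4_converges_boundedly (convolution4 f g) (h, j, k, l) (m, n, o', p) \<and>
         shehu4 (convolution4 f g) (h, j, k, l) (m, n, o', p) =
           shehu4 f (h, j, k, l) (m, n, o', p) * shehu4 g (h, j, k, l) (m, n, o', p)"
proof -
  define \<phi> where "\<phi> f = shehu4_integrand f (h, j, k, l) (m, n, o', p)" for f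
  have bd_iff: "shehu4_converges_boundedly f (h, j, k, l) (m, n, o', p) \<longleftrightarrow>
      \<phi> f integrable_on {0..} \<and> (\<exists>M. \<forall>X\<ge>0. \<bar>integral {0..X} (\<phi> f)\<bar> \<le> M)" for f
    by (force simp: shehu4_converges_boundedly_def \<phi>_def [symmetric] box4_eq orthant4_eq bounded_iff)
  obtain M where int: "(\<phi> f has_integral integral {0..} (\<phi> f)) {0..}"
    and M: "\<And>X. 0 \<le> X \<Longrightarrow> \<bar>integral {0..X} (\<phi> f)\<bar> \<le> M"
    using assms(13) by (auto simp: bd_iff)
  have abs: "\<phi> g absolutely_integrable_on {0..}"
    using assms(14) by (simp add: shehu4_converges_absolutely_def \<phi>_def orthant4_eq)
  have eq: "\<phi> (convolution4 f g) = (\<lambda>x. integral {0..x} (\<lambda>t. \<phi> f (x - t) * \<phi> g t))"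
    unfolding \<phi>_def by (intro ext shehu4_integrand_convolution4 assms)
  have cont: "continuous_on {0..} (\<phi> f)" "continuous_on {0..} (\<phi> g)"
    unfolding \<phi>_def by (intro continuous_on_shehu4_integrand assms)+
  \<comment> \<open>This yields both the value of the transform and, as bound for the box integrals
    of the convolution, \<open>M\<close> times the integral of the absolute value of
    \<open>\<phi> g\<close>.\<close>
  note conv = convolution_has_integral [OF cont int M abs, folded eq]
  then show ?thesis
    unfolding bd_iff shehu4_def orthant4_eq \<phi>_def [symmetric]
    by (blast intro: integral_unique has_integral_integrable)
qed

end
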